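(* Let $\|\cdot\|_\ast$ be a norm on $X_h$ that does not depend on $s$, and let $\eta:D\to(0,\infty)$ be such that $\|w\|_{X_h(\mu)}\le\eta(\mu)\,\|w\|_\ast$ for all $w\in X_h$ and all $\mu\in D$. Define, for $\mu=(s,\nu)\in D$, $$\beta_h(\mu)=\inf_{0\ne w\in X_h}\ \sup_{0\ne v\in X_h}\frac{a^{Q_h}_{\mathrm{EIM}}(w,v;\mu)}{\|w\|_{X_h(\mu)}\,\|v\|_{X_h(\mu)}},\qquad \beta_{h\ast}(\mu)=\inf_{0\ne w\in X_h}\ \sup_{0\ne v\in X_h}\ \sum_{q=1}^{Q_h}\frac{\theta_q(s)}{\eta(\mu)^2}\,\frac{a_q(w,v)}{\|w\|_\ast\,\|v\|_\ast}.$$ If $\beta_{\mathrm{LB}}:D\to\mathbb{R}$ satisfies $0<\beta_{\mathrm{LB}}(\mu)\le\beta_{h\ast}(\mu)$ for all $\mu\in D$, then $0<\beta_{\mathrm{LB}}(\mu)\le\beta_h(\mu)$ for all $\mu\in D$.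
   Context: **Parameters.** $\mu=(s,\nu)\in D=(0,1)\times E\subset\mathbb{R}^p$. For $s\in(0,1)$ put $a(s)=1-2s$ and $d_s=2^{1-2s}\,\Gamma(1-s)/\Gamma(s)$. **Finite element space.** $\Omega\subset\mathbb{R}^n$ ($n\ge1$) is a bounded Lipschitz polygonal/polyhedral domain. Fix $y_+>0$ and $\mathcal{C}_{y_+}=\Omega\times(0,y_+)$, with $\partial_L\mathcal{C}_{y_+}=(\partial\Omega\times[0,y_+])\cup(\Omega\times\{y_+\})$. Let $\mathcal{T}_\Omega$ be a conforming quasi-uniform triangulation of $\Omega$ into simplices or (images of) cubes, and let $0=y_0<y_1<\dots<y_M=y_+$ be a (graded, parameter-independent) partition of $[0,y_+]$ into intervals $I_m=[y_m,y_{m+1}]$. $X_h$ is the finite-dimensional space of functions $V\in C^0(\overline{\mathcal{C}_{y_+}})$ with $V|_{K\times I_m}\in\mathcal{P}_1(K)\otimes\mathbb{P}_1(I_m)$ for all $K\in\mathcal{T}_\Omega$ and all $m$, and $V=0$ on $\partial_L\mathcal{C}_{y_+}$. Here $\mathbb{P}_1$ denotes polynomials of total degree at most 1, $\mathcal{P}_1(K)=\mathbb{P}_1(K)$ for simplices, and $\mathcal{P}_1(K)$ is the space of polynomials of degree at most 1 in each variable for cubes. The parameter-dependent norm on $X_h$ is $$\|w\|_{X_h(\mu)}=\|w\|_{X_h}=\Big(\int_{\mathcal{C}_{y_+}}y^{1-2s}|\nabla w|^2\,dx\,dy\Big)^{1/2},\qquad \mu=(s,\nu).$$ **Bilinear forms.**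 For $s\in(0,1)$ and $w,v\in X_h$ let $a(w,v;s)=\frac1{d_s}\int_{\mathcal{C}_{y_+}}y^{1-2s}\,\nabla w\cdot\nabla v\,dx\,dy$. Fix distinct nodes $s_1,\dots,s_{Q_h}\in(0,1)$ and real-valued coefficient functions $\theta_1,\dots,\theta_{Q_h}$ on $(0,1)$ (obtained from empirical interpolation of $y^{1-2s}$ at these nodes), and set $$a_q(w,v)=a(w,v;s_q),\qquad a^{Q_h}_{\mathrm{EIM}}(w,v;\mu)=\sum_{q=1}^{Q_h}\theta_q(s)\,a_q(w,v).$$ *)

theory Defs
  imports "HOL-Analysis.Analysis"
begin

definition lipschitz_boundary :: "(real^'n) set \<Rightarrow> bool" where
  "lipschitz_boundary \<Omega> \<longleftrightarrow>
    (\<forall>p\<in>frontier \<Omega>. \<exists>U e L \<phi>. open U \<and> p \<in> U \<and> norm e = 1 \<and>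
       L-lipschitz_on {x. x \<bullet> e = 0} \<phi> \<and>
       \<Omega> \<inter> U = {x \<in> U. \<phi> (x - (x \<bullet> e) *\<^sub>R e) < x \<bullet> e})"

definition polyhedral_lipschitz_domain :: "(real^'n) set \<Rightarrow> bool" where
  "polyhedral_lipschitz_domain \<Omega> \<longleftrightarrow>
    open \<Omega> \<and> connected \<Omega> \<and> \<Omega> \<noteq> {} \<and> bounded \<Omega> \<and> lipschitz_boundary \<Omega> \<and>
    (\<exists>\<P>. finite \<P> \<and> (\<forall>P\<in>\<P>. polytope P) \<and> closure \<Omega> = \<Union>\<P>)"

definition cylinder :: "(real^'n) set \<Rightarrow> real \<Rightarrow> ((real^'n) \<times> real) set" where
  "cylinder \<Omega> yp = \<Omega> \<times> {0<..<yp}"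

definition lateral_boundary :: "(real^'n) set \<Rightarrow> real \<Rightarrow> ((real^'n) \<times> real) set" where
  "lateral_boundary \<Omega> yp = (frontier \<Omega> \<times> {0..yp}) \<union> (\<Omega> \<times> {yp})"

text \<open>A cell is either a simplex, given as a point set, or the image of the unit cube
  \<open>cbox 0 1\<close> under an explicitly given map, as usual for isoparametric elements.\<close>

datatype 'a cell = Simplex "'a set" | Cube_Image "'a \<Rightarrow> 'a"

fun cell_set :: "(real^'n) cell \<Rightarrow> (real^'n) set" where
  "cell_set (Simplex K) = K"
| "cell_set (Cube_Image F) = F ` cbox 0 1"

fun cell_faces :: "(real^'n) cell \<Rightarrow> (real^'n) set set" where
  "cell_faces (Simplex K) = {T. T face_of K}"
| "cell_faces (Cube_Image F) = {F ` T | T. T face_of cbox 0 1}"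

text \<open>Polynomials of degree at most one in each variable; the monomials are indexed by the
  sets of variables occurring in them.\<close>

definition multilinear_poly :: "(real^'n \<Rightarrow> real) \<Rightarrow> bool" where
  "multilinear_poly f \<longleftrightarrow> (\<exists>c. \<forall>x. f x = (\<Sum>A\<in>UNIV. c A * (\<Prod>i\<in>A. x $ i)))"

fun valid_cell :: "(real^'n) cell \<Rightarrow> bool" where
  "valid_cell (Simplex K) \<longleftrightarrow> int CARD('n) simplex K"
| "valid_cell (Cube_Image F) \<longleftrightarrow>
     (\<forall>i. multilinear_poly (\<lambda>x. F x $ i)) \<and> inj_on F (cbox 0 1) \<and>
     (\<forall>x\<in>cbox 0 1. det (jacobian F (at x)) \<noteq> 0)"

definition conforming_mesh :: "(real^'n) set \<Rightarrow> (real^'n) cell set \<Rightarrow> bool" where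
  "conforming_mesh \<Omega> \<T> \<longleftrightarrow>
    finite \<T> \<and> (\<forall>K\<in>\<T>. valid_cell K) \<and> (\<Union>K\<in>\<T>. cell_set K) = closure \<Omega> \<and>
    (\<forall>K\<in>\<T>. \<forall>K'\<in>\<T>. K \<noteq> K' \<longrightarrow>
       interior (cell_set K) \<inter> interior (cell_set K') = {} \<and>
       cell_set K \<inter> cell_set K' \<in> cell_faces K \<inter> cell_faces K')"

text \<open>The following combines shape regularity (\<open>K = K'\<close>) with the comparability of the
  diameters of different cells, with constant \<open>\<sigma>\<close>.\<close>

definition quasi_uniform :: "real \<Rightarrow> (real^'n) cell set \<Rightarrow> bool" where
  "quasi_uniform \<sigma> \<T> \<longleftrightarrow>
    (\<forall>K\<in>\<T>. \<forall>K'\<in>\<T>. \<exists>x r. 0 < r \<and> ball x r \<subseteq> cell_set K \<and>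
       diameter (cell_set K') \<le> \<sigma> * r)"

definition interval_partition :: "(nat \<Rightarrow> real) \<Rightarrow> nat \<Rightarrow> real \<Rightarrow> bool" where
  "interval_partition y M yp \<longleftrightarrow> y 0 = 0 \<and> y M = yp \<and> (\<forall>m<M. y m < y (Suc m))"

definition affine_polys :: "('a::real_inner \<Rightarrow> real) set" where
  "affine_polys = {p. \<exists>a b. \<forall>x. p x = a + b \<bullet> x}"

text \<open>For the image of a cube, degrees are measured in the variables of the reference cube.
  If \<open>F\<close> only scales and translates the coordinates, this is the same as being of
  degree at most one in each physical variable on the cell.\<close>

fun cell_polys :: "(real^'n) cell \<Rightarrow> (real^'n \<Rightarrow> real) set" where
  "cell_polys (Simplex K) = affine_polys"
| "cell_polys (Cube_Image F) = {p. \<exists>q. multilinear_poly q \<and> (\<forall>x\<in>cbox 0 1. p (F x) = q x)}"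

definition in_tensor_on ::
  "'a set \<Rightarrow> 'b set \<Rightarrow> ('a \<Rightarrow> real) set \<Rightarrow> ('b \<Rightarrow> real) set \<Rightarrow> ('a \<times> 'b \<Rightarrow> real) \<Rightarrow> bool" where
  "in_tensor_on K I P Q V \<longleftrightarrow>
    (\<exists>(N::nat) p q. (\<forall>k<N. p k \<in> P \<and> q k \<in> Q) \<and>
       (\<forall>x\<in>K. \<forall>y\<in>I. V (x, y) = (\<Sum>k<N. p k x * q k y)))"

text \<open>Functions on the closed cylinder are represented by their extension by zero, so that
  equality in the space is equality of HOL functions. Only the values on the closed cylinder
  matter for continuity.\<close>

definition fe_space ::
  "(real^'n) set \<Rightarrow> (real^'n) cell set \<Rightarrow> (nat \<Rightarrow> real) \<Rightarrow> nat \<Rightarrow> ((real^'n) \<times> real \<Rightarrow> real) set" where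
  "fe_space \<Omega> \<T> y M =
    {V. continuous_on (closure (cylinder \<Omega> (y M))) V \<and>
        (\<forall>z. z \<notin> closure (cylinder \<Omega> (y M)) \<longrightarrow> V z = 0) \<and>
        (\<forall>K\<in>\<T>. \<forall>m<M. in_tensor_on (cell_set K) {y m..y (Suc m)} (cell_polys K) affine_polys V) \<and>
        (\<forall>z\<in>lateral_boundary \<Omega> (y M). V z = 0)}"

definition norm_on :: "('a \<Rightarrow> real) set \<Rightarrow> (('a \<Rightarrow> real) \<Rightarrow> real) \<Rightarrow> bool" where
  "norm_on X N \<longleftrightarrow>
    (\<forall>w\<in>X. 0 \<le> N w \<and> (N w = 0 \<longleftrightarrow> w = (\<lambda>_. 0))) \<and>
    (\<forall>w\<in>X. \<forall>c. N (\<lambda>z. c * w z) = \<bar>c\<bar> * N w) \<and>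
    (\<forall>w\<in>X. \<forall>v\<in>X. N (\<lambda>z. w z + v z) \<le> N w + N v)"

text \<open>A function in the finite element space is differentiable almost everywhere in the
  cylinder, so the value at other points is irrelevant for the integrals below.\<close>

definition grad :: "('a::real_inner \<Rightarrow> real) \<Rightarrow> 'a \<Rightarrow> 'a" where
  "grad w z = (if \<exists>g. GDERIV w z :> g then THE g. GDERIV w z :> g else 0)"

definition fe_norm :: "(real^'n) set \<Rightarrow> real \<Rightarrow> real \<Rightarrow> ((real^'n) \<times> real \<Rightarrow> real) \<Rightarrow> real" where
  "fe_norm \<Omega> yp s w =
    sqrt (LINT z:cylinder \<Omega> yp|lebesgue. snd z powr (1 - 2 * s) * (norm (grad w z))\<^sup>2)"

definition d_const :: "real \<Rightarrow> real" where
  "d_const s = 2 powr (1 - 2 * s) * Gamma (1 - s) / Gamma s"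

definition a_form ::
  "(real^'n) set \<Rightarrow> real \<Rightarrow> real \<Rightarrow> ((real^'n) \<times> real \<Rightarrow> real) \<Rightarrow> ((real^'n) \<times> real \<Rightarrow> real) \<Rightarrow> real" where
  "a_form \<Omega> yp s w v =
    1 / d_const s *
    (LINT z:cylinder \<Omega> yp|lebesgue. snd z powr (1 - 2 * s) * (grad w z \<bullet> grad v z))"

definition a_EIM ::
  "(real^'n) set \<Rightarrow> real \<Rightarrow> nat \<Rightarrow> (nat \<Rightarrow> real) \<Rightarrow> (nat \<Rightarrow> real \<Rightarrow> real) \<Rightarrow> real \<Rightarrow>
   ((real^'n) \<times> real \<Rightarrow> real) \<Rightarrow> ((real^'n) \<times> real \<Rightarrow> real) \<Rightarrow> real" where
  "a_EIM \<Omega> yp Q node \<theta> s w v = (\<Sum>q=1..Q. \<theta> q s * a_form \<Omega> yp (node q) w v)"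

text \<open>The infimum and supremum are taken in the extended reals, so they are meaningful without
  any boundedness assumption; for the trivial space the infimum is \<open>\<infinity>\<close>.\<close>

definition inf_sup ::
  "('a \<Rightarrow> real) set \<Rightarrow> (('a \<Rightarrow> real) \<Rightarrow> ('a \<Rightarrow> real) \<Rightarrow> real) \<Rightarrow> ereal" where
  "inf_sup X b = (INF w \<in> X - {\<lambda>_. 0}. SUP v \<in> X - {\<lambda>_. 0}. ereal (b w v))"

end

theory Submission
  imports Defs
begin

text \<open>Since the weighted norm is at most \<open>\<eta>\<close> times the fixed norm, a positive quotient only grows
  when the fixed norms are replaced by the weighted norms, provided that the weighted norms do not vanish;
  a vanishing one would turn the quotient into the junk value \<open>0\<close>. The work lies in
  excluding this: if the weighted norm of \<open>w\<close> is \<open>0\<close>, then the gradient of \<open>w\<close>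
  vanishes almost everywhere, so that all forms vanish at \<open>w\<close>. As a Bochner integral is
  also \<open>0\<close> when the integrand is not integrable, this needs the gradient to be measurable
  and essentially bounded. On each cell the function is a multiaffine function composed with the
  inverse of a multiaffine map with invertible derivative, so compactness bounds its gradient.\<close>

section \<open>Multiaffine maps\<close>

text \<open>Being affine along every coordinate line is degree at most one in each variable, encoded
  without naming monomials. Thus affine polynomials, multilinear maps on cubes and products in
  separate variables fall under one notion. Differentiability is included so that partial
  derivatives determine the derivative.\<close>

definition multiaffine :: "('a::euclidean_space \<Rightarrow> 'b::euclidean_space) \<Rightarrow> bool" where
  "multiaffine f \<longleftrightarrow> (\<forall>z. f differentiable at z) \<and>
     (\<forall>z t. \<forall>b\<in>Basis. f (z + t *\<^sub>R b) = f z + t *\<^sub>R (f (z + b) - f z))"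

text \<open>Along a basis vector the map is affine, so its partial derivative is a unit difference;
  this makes the derivative jointly continuous in the point and the direction.\<close>

definition unit_diff :: "('a::euclidean_space \<Rightarrow> 'b::euclidean_space) \<Rightarrow> 'a \<Rightarrow> 'a \<Rightarrow> 'b" where
  "unit_diff f z h = (\<Sum>b\<in>Basis. (h \<bullet> b) *\<^sub>R (f (z + b) - f z))"

lemma multiaffineD:
  assumes "multiaffine f" and "b \<in> Basis"
  shows "f (z + t *\<^sub>R b) = f z + t *\<^sub>R (f (z + b) - f z)"
  using assms unfolding multiaffine_def by blast

lemma multiaffine_differentiable: "multiaffine f \<Longrightarrow> f differentiable at z within S"
  unfolding multiaffine_def using differentiable_at_withinI by blast

lemma multiaffine_continuous_on: "multiaffine f \<Longrightarrow> continuous_on S f"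
  by (simp add: continuous_at_imp_continuous_on differentiable_imp_continuous_within
      multiaffine_differentiable)

text \<open>Restricted to a coordinate line, the map is affine with slope
  \<open>f (z + b) - f z\<close>. Uniqueness of derivatives identifies this slope with the value on
  \<open>b\<close> of any derivative, and linearity extends the identity from the basis to all
  directions.\<close>

lemma multiaffine_has_derivative:
  assumes "multiaffine f"
  shows "(f has_derivative unit_diff f z) (at z)"
proof -
  obtain f' where f': "(f has_derivative f') (at z)"
    using multiaffine_differentiable[OF assms] unfolding differentiable_def by blast
  have lin: "linear f'"
    using f' has_derivative_linear by blast
  have base: "f' b = f (z + b) - f z" if b: "b \<in> Basis" for b
  proof -
    have line: "((\<lambda>t. z + t *\<^sub>R b) has_derivative (\<lambda>t. t *\<^sub>R b)) (at (0::real))"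
      by (auto intro!: derivative_eq_intros)
    have "((\<lambda>t. f (z + t *\<^sub>R b)) has_derivative (\<lambda>t. f' (t *\<^sub>R b))) (at (0::real))"
      using has_derivative_compose[OF line, of f f'] f' by simp
    moreover have "((\<lambda>t. f (z + t *\<^sub>R b)) has_derivative (\<lambda>t. t *\<^sub>R (f (z + b) - f z))) (at (0::real))"
      unfolding multiaffineD[OF assms b] by (auto intro!: derivative_eq_intros)
    ultimately have "(\<lambda>t. f' (t *\<^sub>R b)) = (\<lambda>t. t *\<^sub>R (f (z + b) - f z))"
      using has_derivative_unique by blast
    from fun_cong[OF this, of 1] show ?thesis by simp
  qed
  have "f' h = unit_diff f z h" for h
  proof -
    have "f' h = f' (\<Sum>b\<in>Basis. (h \<bullet> b) *\<^sub>R b)"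
      by (simp add: euclidean_representation)
    also have "\<dots> = unit_diff f z h"
      unfolding unit_diff_def linear_sum[OF lin] by (simp add: linear_cmul[OF lin] base)
    finally show ?thesis .
  qed
  then have "f' = unit_diff f z" by blast
  with f' show ?thesis by simp
qed

lemma continuous_on_unit_diff:
  assumes "multiaffine f"
  shows "continuous_on S (\<lambda>(z, h). unit_diff f z h)"
proof -
  have "continuous_on UNIV f"
    by (rule multiaffine_continuous_on[OF assms])
  note comp = continuous_on_compose2[OF this _ subset_UNIV]
  show ?thesis
    unfolding unit_diff_def case_prod_beta by (intro continuous_intros comp)
qed

section \<open>Closure properties and examples of multiaffine maps\<close>

lemma multiaffine_const: "multiaffine (\<lambda>_. c)"
  by (simp add: multiaffine_def)

lemma multiaffine_add: "multiaffine f \<Longrightarrow> multiaffine g \<Longrightarrow> multiaffine (\<lambda>z. f z + g z)"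
  by (simp add: multiaffine_def algebra_simps)

lemma multiaffine_sum:
  assumes "\<And>i. i \<in> I \<Longrightarrow> multiaffine (f i)"
  shows "multiaffine (\<lambda>z. \<Sum>i\<in>I. f i z)"
  using assms by (induction I rule: infinite_finite_induct) (auto intro: multiaffine_const multiaffine_add)

lemma multiaffine_linear:
  assumes "bounded_linear f"
  shows "multiaffine f"
  unfolding multiaffine_def
proof (intro conjI allI ballI)
  fix z t and b :: 'a
  interpret bounded_linear f by (rule assms)
  show "f differentiable at z"
    using bounded_linear_imp_differentiable[OF assms] .
  show "f (z + t *\<^sub>R b) = f z + t *\<^sub>R (f (z + b) - f z)"
    by (simp add: add scale)
qed

lemma multiaffine_componentwise:
  fixes f :: "'a::euclidean_space \<Rightarrow> 'b::euclidean_space"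
  assumes "\<And>i. i \<in> Basis \<Longrightarrow> multiaffine (\<lambda>z. f z \<bullet> i)"
  shows "multiaffine f"
  unfolding multiaffine_def
proof (intro conjI allI ballI)
  fix z t and b :: 'a assume b: "b \<in> Basis"
  show "f (z + t *\<^sub>R b) = f z + t *\<^sub>R (f (z + b) - f z)"
  proof (rule euclidean_eqI)
    fix i :: 'b assume "i \<in> Basis"
    from multiaffineD[OF assms[OF this] b]
    show "f (z + t *\<^sub>R b) \<bullet> i = (f z + t *\<^sub>R (f (z + b) - f z)) \<bullet> i"
      by (simp add: inner_add_left inner_diff_left)
  qed
next
  fix z
  show "f differentiable at z"
    using assms by (subst differentiable_componentwise_within) (blast intro: multiaffine_differentiable)
qed

text \<open>A basis vector of the product space moves only one of the two components, so one factor
  stays constant while the other changes affinely. A product in a shared variable would in general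
  be quadratic.\<close>

lemma multiaffine_times_vars:
  fixes f :: "'a::euclidean_space \<Rightarrow> real" and g :: "'b::euclidean_space \<Rightarrow> real"
  assumes f: "multiaffine f" and g: "multiaffine g"
  shows "multiaffine (\<lambda>z. f (fst z) * g (snd z))"
  unfolding multiaffine_def
proof (intro conjI allI ballI)
  fix z :: "'a \<times> 'b" and t and b :: "'a \<times> 'b" assume "b \<in> Basis"
  then consider (1) i where "b = (i, 0)" "i \<in> Basis" | (2) j where "b = (0, j)" "j \<in> Basis"
    unfolding Basis_prod_def by blast
  then show "f (fst (z + t *\<^sub>R b)) * g (snd (z + t *\<^sub>R b)) =
      f (fst z) * g (snd z) + t *\<^sub>R (f (fst (z + b)) * g (snd (z + b)) - f (fst z) * g (snd z))"
    by cases (simp_all add: multiaffineD[OF f, of _ _ t] multiaffineD[OF g, of _ _ t] algebra_simps)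
next
  fix z :: "'a \<times> 'b"
  have "(\<lambda>z. f (fst z)) differentiable at z" "(\<lambda>z. g (snd z)) differentiable at z"
    using differentiable_chain_at[OF bounded_linear_imp_differentiable[OF bounded_linear_fst]
        multiaffine_differentiable[OF f]]
      differentiable_chain_at[OF bounded_linear_imp_differentiable[OF bounded_linear_snd]
        multiaffine_differentiable[OF g]]
    by (simp_all add: o_def)
  then show "(\<lambda>z. f (fst z) * g (snd z)) differentiable at z"
    by (rule differentiable_mult)
qed

lemma multiaffine_map_prod_id:
  fixes F :: "'a::euclidean_space \<Rightarrow> 'c::euclidean_space"
  assumes "multiaffine F"
  shows "multiaffine (\<lambda>z :: 'a \<times> 'b::euclidean_space. (F (fst z), snd z))"
  unfolding multiaffine_def
proof (intro conjI allI ballI)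
  fix z :: "'a \<times> 'b" and t and b :: "'a \<times> 'b" assume "b \<in> Basis"
  then consider (1) i where "b = (i, 0)" "i \<in> Basis" | (2) j where "b = (0, j)" "j \<in> Basis"
    unfolding Basis_prod_def by blast
  then show "(F (fst (z + t *\<^sub>R b)), snd (z + t *\<^sub>R b)) =
      (F (fst z), snd z) + t *\<^sub>R ((F (fst (z + b)), snd (z + b)) - (F (fst z), snd z))"
    by cases (simp_all add: multiaffineD[OF assms, of _ _ t] algebra_simps)
next
  fix z :: "'a \<times> 'b"
  have "((\<lambda>z. F (fst z)) has_derivative (\<lambda>h. unit_diff F (fst z) (fst h))) (at z)"
    using has_derivative_compose[OF has_derivative_fst[OF has_derivative_ident]
        multiaffine_has_derivative[OF assms]] .
  then have "((\<lambda>z. (F (fst z), snd z)) has_derivative (\<lambda>h. (unit_diff F (fst z) (fst h), snd h))) (at z)"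
    by (auto intro!: derivative_eq_intros)
  then show "(\<lambda>z. (F (fst z), snd z)) differentiable at z"
    unfolding differentiable_def by blast
qed

text \<open>Uniqueness of the derivative gives the block form, which reduces triviality of the
  kernel on the cylinder to triviality of the kernel of \<open>unit_diff F\<close>.\<close>

lemma unit_diff_map_prod_id:
  fixes F :: "'a::euclidean_space \<Rightarrow> 'c::euclidean_space"
  assumes "multiaffine F"
  shows "unit_diff (\<lambda>z :: 'a \<times> 'b::euclidean_space. (F (fst z), snd z)) z h =
    (unit_diff F (fst z) (fst h), snd h)"
proof -
  have "((\<lambda>z. F (fst z)) has_derivative (\<lambda>h. unit_diff F (fst z) (fst h))) (at z)"
    using has_derivative_compose[OF has_derivative_fst[OF has_derivative_ident]
        multiaffine_has_derivative[OF assms]] .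
  then have "((\<lambda>z. (F (fst z), snd z)) has_derivative (\<lambda>h. (unit_diff F (fst z) (fst h), snd h))) (at z)"
    by (auto intro!: derivative_eq_intros)
  from fun_cong[OF has_derivative_unique[OF this
        multiaffine_has_derivative[OF multiaffine_map_prod_id[OF assms]]], of h]
  show ?thesis by simp
qed

lemma multiaffine_monomial:
  fixes A :: "'n::finite set"
  shows "multiaffine (\<lambda>x::real^'n. \<Prod>i\<in>A. x $ i)"
  unfolding multiaffine_def
proof (intro conjI allI ballI)
  fix z :: "real^'n" and t and b :: "real^'n" assume "b \<in> Basis"
  then obtain j where b: "b = axis j 1"
    by (auto simp: Basis_vec_def)
  show "(\<Prod>i\<in>A. (z + t *\<^sub>R b) $ i) =
      (\<Prod>i\<in>A. z $ i) + t *\<^sub>R ((\<Prod>i\<in>A. (z + b) $ i) - (\<Prod>i\<in>A. z $ i))"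
  proof (cases "j \<in> A")
    case True
    \<comment> \<open>Each variable occurs at most once, so the moving one splits off as a single
      linear factor. The instances at \<open>t\<close>, 0 and 1 combine to the affine law.\<close>
    have eq: "(\<Prod>i\<in>A. (z + t *\<^sub>R b) $ i) = (z $ j + t) * (\<Prod>i\<in>A - {j}. z $ i)" for t
      unfolding prod.remove[OF finite True] b
      by (auto simp: axis_def intro!: prod.cong)
    from eq[of t] eq[of 0] eq[of 1] show ?thesis
      by (simp add: algebra_simps)
  next
    case False
    have eq: "(\<Prod>i\<in>A. (z + t *\<^sub>R b) $ i) = (\<Prod>i\<in>A. z $ i)" for t
      unfolding b using False by (auto simp: axis_def intro!: prod.cong)
    from eq[of t] eq[of 1] show ?thesis
      by simp
  qed
next
  fix z :: "real^'n"
  have "((\<lambda>x. \<Prod>i\<in>A. x $ i) has_derivative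
      (\<lambda>h. \<Sum>i\<in>A. h $ i * (\<Prod>j\<in>A - {i}. z $ j))) (at z)"
    by (intro has_derivative_prod bounded_linear_imp_has_derivative bounded_linear_vec_nth)
  then show "(\<lambda>x. \<Prod>i\<in>A. x $ i) differentiable at z"
    unfolding differentiable_def by blast
qed

lemma multiaffine_scale: "multiaffine f \<Longrightarrow> multiaffine (\<lambda>z. c *\<^sub>R f z)"
  by (auto simp: multiaffine_def scaleR_diff_right scaleR_add_right mult.commute)

lemma multilinear_poly_multiaffine: "multilinear_poly f \<Longrightarrow> multiaffine f"
proof -
  assume "multilinear_poly f"
  then obtain c where c: "f = (\<lambda>x. \<Sum>A\<in>UNIV. c A *\<^sub>R (\<Prod>i\<in>A. x $ i))"
    unfolding multilinear_poly_def by auto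
  show "multiaffine f"
    unfolding c by (intro multiaffine_sum multiaffine_scale multiaffine_monomial)
qed

lemma affine_polys_multiaffine:
  fixes p :: "'a::euclidean_space \<Rightarrow> real"
  assumes "p \<in> affine_polys"
  shows "multiaffine p"
proof -
  obtain a b where p: "p = (\<lambda>x. a + b \<bullet> x)"
    using assms unfolding affine_polys_def by auto
  show ?thesis
    unfolding p by (intro multiaffine_add multiaffine_const multiaffine_linear bounded_linear_inner_right)
qed

section \<open>Bounded gradients on images of multiaffine maps\<close>

text \<open>Riesz representation: the adjoint at 1 is the gradient, and testing the bound on the
  gradient itself bounds its norm.\<close>

lemma has_derivative_bounded_imp_gderiv:
  fixes f :: "'a::euclidean_space \<Rightarrow> real"
  assumes "(f has_derivative f') (at z)" and bound: "\<And>h. \<bar>f' h\<bar> \<le> C * norm h"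
  shows "\<exists>g. GDERIV f z :> g \<and> norm g \<le> C"
proof -
  define g where "g = adjoint f' 1"
  have "f' h = h \<bullet> g" for h
    using adjoint_works[OF has_derivative_linear[OF assms(1)], of h 1] by (simp add: g_def)
  then have f': "f' = (\<lambda>h. h \<bullet> g)" by blast
  have "norm g * norm g \<le> C * norm g"
    using bound[of g] by (simp add: f' dot_square_norm power2_eq_square)
  \<comment> \<open>Needed when \<open>g = 0\<close>, where one cannot cancel \<open>norm g\<close>;
    any basis vector, having norm 1, serves as test direction.\<close>
  moreover have "0 \<le> C"
    using bound[of "SOME b. b \<in> Basis"] abs_ge_zero[of "f' (SOME b. b \<in> Basis)"]
    by (simp add: some_in_eq)
  ultimately have "norm g \<le> C"
    by (cases "g = 0") auto
  then show ?thesis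
    using assms(1) unfolding gderiv_def f' by blast
qed

lemma grad_eq:
  assumes "GDERIV w z :> g"
  shows "grad w z = g"
proof -
  have "g' = g" if "GDERIV w z :> g'" for g'
  proof -
    have "(\<lambda>h. h \<bullet> g') = (\<lambda>h. h \<bullet> g)"
      using has_derivative_unique that assms unfolding gderiv_def by blast
    from fun_cong[OF this, of "g' - g"] have "(g' - g) \<bullet> (g' - g) = 0"
      by (simp add: inner_diff_right)
    then show ?thesis by simp
  qed
  then have "(THE g. GDERIV w z :> g) = g"
    using assms by (rule the_equality[rotated])
  then show ?thesis
    using assms unfolding grad_def by auto
qed

text \<open>On the image, \<open>V\<close> is \<open>W\<close> composed with the inverse of
  \<open>\<Phi>\<close>, so the chain rule yields the bound \<open>K / c\<close>. Here
  \<open>c\<close> is the least stretching of unit vectors by the derivative of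
  \<open>\<Phi>\<close> and \<open>K\<close> bounds the derivative of \<open>W\<close> on unit
  vectors, both over the compact set \<open>S\<close>; \<open>c\<close> is positive because the
  kernels are trivial.\<close>

lemma gradient_bounded_on_image:
  fixes \<Phi> :: "'a::euclidean_space \<Rightarrow> 'a" and W :: "'a \<Rightarrow> real"
  assumes \<Phi>: "multiaffine \<Phi>" and W: "multiaffine W" and S: "compact S" "inj_on \<Phi> S"
    and inj: "\<And>z h. z \<in> S \<Longrightarrow> unit_diff \<Phi> z h = 0 \<Longrightarrow> h = 0"
    and V: "\<And>z. z \<in> S \<Longrightarrow> V (\<Phi> z) = W z"
  obtains C where "\<And>z. z \<in> \<Phi> ` interior S \<Longrightarrow> \<exists>g. GDERIV V z :> g \<and> norm g \<le> C"
proof (cases "interior S = {}")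
  case True
  then show ?thesis using that by auto
next
  case False
  let ?B = "S \<times> sphere (0::'a) 1"
  have cB: "compact ?B"
    using S compact_Times compact_sphere by blast
  obtain b :: 'a where "b \<in> Basis" using nonempty_Basis by blast
  then have neB: "?B \<noteq> {}"
    using False interior_subset[of S] by auto
  have "continuous_on ?B (\<lambda>p. norm (case p of (z, h) \<Rightarrow> unit_diff \<Phi> z h))"
    by (intro continuous_on_norm continuous_on_unit_diff \<Phi>)
  from continuous_attains_inf[OF cB neB this] obtain z0 h0 where
    zh0: "z0 \<in> S" "norm h0 = 1" and
    min: "\<And>z h. z \<in> S \<Longrightarrow> norm h = 1 \<Longrightarrow> norm (unit_diff \<Phi> z0 h0) \<le> norm (unit_diff \<Phi> z h)"
    by auto
  define c where "c = norm (unit_diff \<Phi> z0 h0)"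
  have c: "0 < c"
    using inj[OF zh0(1), of h0] zh0(2) unfolding c_def by auto
  have "bounded ((\<lambda>(z, h). unit_diff W z h) ` ?B)"
    using compact_imp_bounded[OF compact_continuous_image[OF continuous_on_unit_diff[OF W] cB]] .
  then obtain K where K: "\<And>z h. z \<in> S \<Longrightarrow> norm h = 1 \<Longrightarrow> \<bar>unit_diff W z h\<bar> \<le> K"
    unfolding bounded_iff by force
  show ?thesis
  proof (rule that)
    fix p assume "p \<in> \<Phi> ` interior S"
    then obtain z where z: "z \<in> interior S" and p: "p = \<Phi> z" by blast
    have zS: "z \<in> S" using z interior_subset by blast
    define \<Psi> where "\<Psi> = inv_into S \<Phi>"
    have \<Psi>: "\<Psi> (\<Phi> x) = x" if "x \<in> S" for x
      unfolding \<Psi>_def using S(2) that by simp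
    have lin: "linear (unit_diff \<Phi> z)" "linear (unit_diff W z)"
      using multiaffine_has_derivative \<Phi> W has_derivative_linear by blast+
    have "inj (unit_diff \<Phi> z)"
      using linear_injective_0[OF lin(1)] inj[OF zS] by blast
    then obtain \<psi> where \<psi>: "linear \<psi>" "\<And>h. \<psi> (unit_diff \<Phi> z h) = h" "\<And>h. unit_diff \<Phi> z (\<psi> h) = h"
      using linear_injective_isomorphism[OF lin(1)] by blast
    have lower: "c * norm h \<le> norm (unit_diff \<Phi> z h)" for h
    proof (cases "h = 0")
      case False
      have "c \<le> norm (unit_diff \<Phi> z (h /\<^sub>R norm h))"
        unfolding c_def using False by (intro min zS) simp
      then show ?thesis
        using False by (simp add: linear_cmul[OF lin(1)] field_simps)
    qed simp
    have upper: "\<bar>unit_diff W z h\<bar> \<le> K * norm h" for h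
    proof (cases "h = 0")
      case False
      have "\<bar>unit_diff W z (h /\<^sub>R norm h)\<bar> \<le> K"
        using False by (intro K zS) simp
      then show ?thesis
        using False by (simp add: linear_cmul[OF lin(2)] abs_mult field_simps)
    qed (simp add: linear_0[OF lin(2)])
    have "0 \<le> K" using K[OF zh0] by linarith
    have "(\<Psi> has_derivative \<psi>) (at (\<Phi> z))"
    proof (rule has_derivative_inverse_strong[OF open_interior z])
      show "continuous_on (interior S) \<Phi>"
        by (rule multiaffine_continuous_on[OF \<Phi>])
      show "\<Psi> (\<Phi> x) = x" if "x \<in> interior S" for x
        using that interior_subset \<Psi> by blast
      show "(\<Phi> has_derivative unit_diff \<Phi> z) (at z)"
        by (rule multiaffine_has_derivative[OF \<Phi>])
      show "unit_diff \<Phi> z \<circ> \<psi> = id"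
        using \<psi>(3) by auto
    qed
    then have comp: "((\<lambda>q. W (\<Psi> q)) has_derivative (\<lambda>h. unit_diff W z (\<psi> h))) (at p)"
      unfolding p by (rule has_derivative_compose) (simp add: \<Psi>[OF zS] multiaffine_has_derivative[OF W])
    \<comment> \<open>Invariance of domain: \<open>V\<close> agrees with the composition on a whole
      neighbourhood of \<open>p\<close>, and so inherits its derivative there.\<close>
    have "open (\<Phi> ` interior S)"
      using multiaffine_continuous_on[OF \<Phi>] S(2)
      by (intro invariance_of_domain open_interior) (simp_all add: inj_on_subset[OF _ interior_subset])
    then have "(V has_derivative (\<lambda>h. unit_diff W z (\<psi> h))) (at p)"
    proof (rule has_derivative_transform_within_open[OF comp])
      show "p \<in> \<Phi> ` interior S" using z p by blast
      show "W (\<Psi> q) = V q" if "q \<in> \<Phi> ` interior S" for q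
        using that interior_subset V \<Psi> by fastforce
    qed
    \<comment> \<open>The lower stretching bound, applied to \<open>\<psi> h\<close>, bounds the
      inverse derivative by \<open>1 / c\<close>.\<close>
    moreover have "\<bar>unit_diff W z (\<psi> h)\<bar> \<le> K / c * norm h" for h
    proof -
      have "norm (\<psi> h) \<le> norm h / c"
        using lower[of "\<psi> h"] c by (simp add: \<psi>(3) field_simps)
      then have "K * norm (\<psi> h) \<le> K * (norm h / c)"
        using \<open>0 \<le> K\<close> by (rule mult_left_mono)
      with upper[of "\<psi> h"] show ?thesis by simp
    qed
    ultimately show "\<exists>g. GDERIV V p :> g \<and> norm g \<le> K / c"
      by (rule has_derivative_bounded_imp_gderiv)
  qed
qed

section \<open>The finite element space\<close>

text \<open>Lets both kinds of cell be treated alike. A simplex is its own reference cell under the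
  identity; the image of a cube is referred to the unit cube by its defining map. The admissible
  polynomials pull back to multiaffine functions in either case.\<close>

lemma reference_cell:
  fixes K :: "(real^'n) cell"
  assumes "valid_cell K"
  obtains F :: "real^'n \<Rightarrow> real^'n" and S where "multiaffine F" "compact S" "convex S" "cell_set K = F ` S" "inj_on F S"
    "\<forall>x\<in>S. \<forall>h. unit_diff F x h = 0 \<longrightarrow> h = 0"
    "\<forall>p\<in>cell_polys K. \<exists>q. multiaffine q \<and> (\<forall>x\<in>S. p (F x) = q x)"
proof (cases K)
  case (Simplex T)
  have T: "int CARD('n) simplex T" using assms Simplex by simp
  have ma: "multiaffine (\<lambda>x::real^'n. x)"
    by (intro multiaffine_linear bounded_linear_ident)
  have "h = 0" if "unit_diff (\<lambda>x::real^'n. x) x h = 0" for x h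
    using that by (simp add: unit_diff_def euclidean_representation)
  then show ?thesis
    using that[of "\<lambda>x. x" T] T ma Simplex affine_polys_multiaffine
    by (auto simp: compact_simplex convex_simplex)
next
  case (Cube_Image F)
  have comp: "multilinear_poly (\<lambda>x. F x $ i)" and inj: "inj_on F (cbox 0 1)"
    and det: "x \<in> cbox 0 1 \<Longrightarrow> det (jacobian F (at x)) \<noteq> 0" for i x
    using assms Cube_Image by auto
  have F: "multiaffine F"
    by (rule multiaffine_componentwise)
      (auto simp: Basis_vec_def inner_axis intro: multilinear_poly_multiaffine[OF comp])
  have "h = 0" if x: "x \<in> cbox 0 1" and h: "unit_diff F x h = 0" for x h
  proof -
    \<comment> \<open>The Jacobian matrix represents the same derivative as
      \<open>unit_diff F x\<close>, so a nonzero determinant gives a trivial kernel.\<close>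
    have "(F has_derivative (*v) (jacobian F (at x))) (at x)"
      using jacobian_works multiaffine_differentiable[OF F] by blast
    then have "jacobian F (at x) *v h = 0"
      using has_derivative_unique[OF multiaffine_has_derivative[OF F]] h by metis
    moreover have "inj ((*v) (jacobian F (at x)))"
      using det[OF x] by (metis invertible_det_nz invertible_def matrix_left_invertible_injective)
    ultimately show ?thesis
      by (metis injD matrix_vector_mult_0_right)
  qed
  moreover have "\<exists>q. multiaffine q \<and> (\<forall>x\<in>cbox 0 1. p (F x) = q x)" if "p \<in> cell_polys K" for p
    using that Cube_Image multilinear_poly_multiaffine by auto
  ultimately show ?thesis
    using that[of F "cbox 0 1"] F inj Cube_Image by (simp add: compact_cbox convex_box)
qed

text \<open>Pulled back to the reference cell times the interval, a finite element function is multiaffine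
  in all variables.\<close>

lemma fe_gradient_on_cell:
  fixes K :: "(real^'n) cell" and a b :: real
  assumes K: "valid_cell K" and V: "in_tensor_on (cell_set K) {a..b} (cell_polys K) affine_polys V"
  obtains U C where "open U" "negligible (cell_set K \<times> {a..b} - U)"
    "\<And>z. z \<in> U \<Longrightarrow> \<exists>g. GDERIV V z :> g \<and> norm g \<le> C"
proof -
  obtain F :: "real^'n \<Rightarrow> real^'n" and S where F: "multiaffine F"
    and S: "compact S" "convex S" "cell_set K = F ` S" "inj_on F S"
    and F0: "\<forall>x\<in>S. \<forall>h. unit_diff F x h = 0 \<longrightarrow> h = 0"
    and polys: "\<forall>p\<in>cell_polys K. \<exists>q. multiaffine q \<and> (\<forall>x\<in>S. p (F x) = q x)"
    using reference_cell[OF K] by blast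
  obtain N :: nat and p r where pr: "\<And>k. k < N \<Longrightarrow> p k \<in> cell_polys K" "\<And>k. k < N \<Longrightarrow> r k \<in> affine_polys"
    and Veq: "\<And>x y. x \<in> cell_set K \<Longrightarrow> y \<in> {a..b} \<Longrightarrow> V (x, y) = (\<Sum>k<N. p k x * r k y)"
    using V unfolding in_tensor_on_def by blast
  have "\<forall>k. \<exists>q. k < N \<longrightarrow> multiaffine q \<and> (\<forall>x\<in>S. p k (F x) = q x)"
    using polys pr(1) by blast
  then obtain q where q: "\<And>k. k < N \<Longrightarrow> multiaffine (q k)"
    "\<And>k x. k < N \<Longrightarrow> x \<in> S \<Longrightarrow> p k (F x) = q k x"
    by metis
  define \<Phi> where "\<Phi> = (\<lambda>z :: (real^'n) \<times> real. (F (fst z), snd z))"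
  define W where "W = (\<lambda>z :: (real^'n) \<times> real. \<Sum>k<N. q k (fst z) * r k (snd z))"
  define B where "B = S \<times> {a..b}"
  have \<Phi>: "multiaffine \<Phi>"
    unfolding \<Phi>_def by (rule multiaffine_map_prod_id[OF F])
  have W: "multiaffine W"
    unfolding W_def using q(1) affine_polys_multiaffine[OF pr(2)]
    by (intro multiaffine_sum multiaffine_times_vars) auto
  have B: "compact B" "convex B"
    unfolding B_def using S(1,2) by (auto intro: compact_Times convex_Times)
  have inj: "inj_on \<Phi> B"
    using S(4) unfolding \<Phi>_def B_def inj_on_def by auto
  have image: "\<Phi> ` B = cell_set K \<times> {a..b}"
    unfolding \<Phi>_def B_def S(3) by force
  have deriv: "h = 0" if "z \<in> B" "unit_diff \<Phi> z h = 0" for z h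
    using that F0 unfolding \<Phi>_def B_def unit_diff_map_prod_id[OF F]
    by (auto simp: prod_eq_iff)
  have VW: "V (\<Phi> z) = W z" if "z \<in> B" for z
    using that unfolding \<Phi>_def B_def W_def by (auto simp: Veq S(3) q(2) intro!: sum.cong)
  obtain C where C: "\<And>z. z \<in> \<Phi> ` interior B \<Longrightarrow> \<exists>g. GDERIV V z :> g \<and> norm g \<le> C"
    by (rule gradient_bounded_on_image[where V = V, OF \<Phi> W B(1) inj]) (use deriv VW in blast)+
  show ?thesis
  proof (rule that)
    show "open (\<Phi> ` interior B)"
      using multiaffine_continuous_on[OF \<Phi>] inj
      by (intro invariance_of_domain open_interior) (simp_all add: inj_on_subset[OF _ interior_subset])
    \<comment> \<open>What the open set misses comes from the frontier of the convex set
      \<open>B\<close>. That frontier is a null set, and differentiable maps between spaces of equal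
      dimension preserve null sets.\<close>
    have "negligible (\<Phi> ` frontier B)"
      using multiaffine_differentiable[OF \<Phi>] negligible_convex_frontier[OF B(2)]
      by (intro negligible_differentiable_image_negligible) (auto simp: differentiable_on_def)
    moreover have "cell_set K \<times> {a..b} - \<Phi> ` interior B \<subseteq> \<Phi> ` frontier B"
      unfolding image[symmetric] frontier_def using closure_subset[of B] by auto
    ultimately show "negligible (cell_set K \<times> {a..b} - \<Phi> ` interior B)"
      by (rule negligible_subset)
  qed (rule C)
qed

text \<open>The interval ends at the first node beyond \<open>t\<close>. This node is not
  \<open>y 0\<close>, since \<open>y 0 = 0 \<le> t\<close>, so it has a predecessor, which by
  minimality does not exceed \<open>t\<close>.\<close>

lemma interval_partition_cover:
  assumes "interval_partition y M yp" "t \<in> {0..<yp}"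
  obtains m where "m < M" "t \<in> {y m..y (Suc m)}"
proof -
  let ?m = "LEAST m. t < y m"
  have M: "t < y M" using assms unfolding interval_partition_def by auto
  then have L: "t < y ?m" by (rule LeastI)
  have "?m \<le> M" using M by (rule Least_le)
  moreover have "?m \<noteq> 0"
  proof
    assume "?m = 0"
    with L have "t < y 0" by simp
    then show False using assms unfolding interval_partition_def by auto
  qed
  ultimately obtain m where m: "?m = Suc m" "m < M"
    by (metis Suc_le_lessD not0_implies_Suc)
  have "\<not> t < y m"
    using not_less_Least[of m "\<lambda>m. t < y m"] m by simp
  with L m show ?thesis
    by (intro that[of m]) auto
qed

text \<open>Finitely many products of a cell and an interval cover the cylinder, so the exceptional
  sets still have a null union and the local bounds have a common one.\<close>

lemma fe_gradient_bounded:
  fixes \<Omega> :: "(real^'n) set"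
  assumes mesh: "conforming_mesh \<Omega> \<T>" and part: "interval_partition y M yp"
    and V: "V \<in> fe_space \<Omega> \<T> y M"
  obtains U C where "open U" "negligible (cylinder \<Omega> yp - U)"
    "\<And>z. z \<in> U \<Longrightarrow> \<exists>g. GDERIV V z :> g \<and> norm g \<le> C"
proof -
  define J where "J = \<T> \<times> {..<M}"
  have J: "finite J"
    using mesh unfolding J_def conforming_mesh_def by simp
  have "\<exists>U C. open U \<and> negligible (cell_set K \<times> {y m..y (Suc m)} - U) \<and>
      (\<forall>z\<in>U. \<exists>g. GDERIV V z :> g \<and> norm g \<le> C)" if "(K, m) \<in> J" for K m
  proof -
    have "valid_cell K" "in_tensor_on (cell_set K) {y m..y (Suc m)} (cell_polys K) affine_polys V"
      using that mesh V unfolding J_def conforming_mesh_def fe_space_def by auto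
    from fe_gradient_on_cell[OF this] show ?thesis by metis
  qed
  then have "\<forall>j\<in>J. \<exists>U C. open U \<and> negligible (cell_set (fst j) \<times> {y (snd j)..y (Suc (snd j))} - U) \<and>
      (\<forall>z\<in>U. \<exists>g. GDERIV V z :> g \<and> norm g \<le> C)"
    by auto
  from bchoice[OF this] obtain U where "\<forall>j\<in>J. \<exists>C. open (U j) \<and>
      negligible (cell_set (fst j) \<times> {y (snd j)..y (Suc (snd j))} - U j) \<and>
      (\<forall>z\<in>U j. \<exists>g. GDERIV V z :> g \<and> norm g \<le> C)" ..
  from bchoice[OF this] obtain C where "\<forall>j\<in>J. open (U j) \<and>
      negligible (cell_set (fst j) \<times> {y (snd j)..y (Suc (snd j))} - U j) \<and>
      (\<forall>z\<in>U j. \<exists>g. GDERIV V z :> g \<and> norm g \<le> C j)" ..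
  then have U: "\<And>j. j \<in> J \<Longrightarrow> open (U j)"
    and neg: "\<And>j. j \<in> J \<Longrightarrow> negligible (cell_set (fst j) \<times> {y (snd j)..y (Suc (snd j))} - U j)"
    and C: "\<And>j. j \<in> J \<Longrightarrow> \<forall>z\<in>U j. \<exists>g. GDERIV V z :> g \<and> norm g \<le> C j"
    by simp_all
  show ?thesis
  \<comment> \<open>The sum dominates every local bound and makes sense for empty \<open>J\<close>.
    Absolute values are taken because \<open>C j\<close> may be negative when \<open>U j\<close> is
    empty.\<close>
  proof (rule that[of "\<Union>j\<in>J. U j" "\<Sum>j\<in>J. \<bar>C j\<bar>"])
    show "open (\<Union>j\<in>J. U j)" using U by blast
    have "cylinder \<Omega> yp \<subseteq> (\<Union>j\<in>J. cell_set (fst j) \<times> {y (snd j)..y (Suc (snd j))})"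
    proof
      fix z assume "z \<in> cylinder \<Omega> yp"
      then have z: "fst z \<in> \<Omega>" "snd z \<in> {0..<yp}"
        unfolding cylinder_def by auto
      then have "fst z \<in> (\<Union>K\<in>\<T>. cell_set K)"
        using mesh subsetD[OF closure_subset z(1)] unfolding conforming_mesh_def by simp
      then obtain K where "K \<in> \<T>" "fst z \<in> cell_set K" by blast
      moreover obtain m where "m < M" "snd z \<in> {y m..y (Suc m)}"
        using interval_partition_cover[OF part z(2)] by blast
      ultimately show "z \<in> (\<Union>j\<in>J. cell_set (fst j) \<times> {y (snd j)..y (Suc (snd j))})"
        unfolding J_def by (intro UN_I[of "(K, m)"]) (auto simp: mem_Times_iff)
    qed
    then have "cylinder \<Omega> yp - (\<Union>j\<in>J. U j) \<subseteq>
        (\<Union>j\<in>J. cell_set (fst j) \<times> {y (snd j)..y (Suc (snd j))} - U j)"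
      by blast
    moreover have "negligible (\<Union>j\<in>J. cell_set (fst j) \<times> {y (snd j)..y (Suc (snd j))} - U j)"
      using J neg by (intro negligible_Union) auto
    ultimately show "negligible (cylinder \<Omega> yp - (\<Union>j\<in>J. U j))"
      using negligible_subset by blast
    fix z assume "z \<in> (\<Union>j\<in>J. U j)"
    then obtain j where j: "j \<in> J" "z \<in> U j" by blast
    have "\<bar>C j\<bar> \<le> (\<Sum>j\<in>J. \<bar>C j\<bar>)"
      using J j(1) by (intro member_le_sum) auto
    then show "\<exists>g. GDERIV V z :> g \<and> norm g \<le> (\<Sum>j\<in>J. \<bar>C j\<bar>)"
      using bspec[OF C[OF j(1)] j(2)] by force
  qed
qed

section \<open>Integrability\<close>

text \<open>Each component of the gradient is a pointwise limit of difference quotients of a Borel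
  function. The indicator discards points where differentiability is unknown.\<close>

lemma borel_measurable_grad:
  fixes V :: "'a::euclidean_space \<Rightarrow> real"
  assumes V [measurable]: "V \<in> borel_measurable borel" and U: "open U"
    and grad: "\<And>z. z \<in> U \<Longrightarrow> \<exists>g. GDERIV V z :> g"
  shows "(\<lambda>z. indicator U z *\<^sub>R grad V z) \<in> borel_measurable borel"
proof (subst borel_measurable_euclidean_space, intro ballI)
  fix b :: 'a
  have [measurable]: "U \<in> sets borel" using U by simp
  \<comment> \<open>Difference quotient with step \<open>1 / Suc n\<close>, which is never zero and
    tends to 0.\<close>
  define d where "d = (\<lambda>n z. indicator U z * ((V (z + (1 / real (Suc n)) *\<^sub>R b) - V z) * real (Suc n)))"
  show "(\<lambda>z. (indicator U z *\<^sub>R grad V z) \<bullet> b) \<in> borel_measurable borel"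
  proof (rule borel_measurable_LIMSEQ_real)
    show "d n \<in> borel_measurable borel" for n
      unfolding d_def by measurable
    fix z
    show "(\<lambda>n. d n z) \<longlonglongrightarrow> (indicator U z *\<^sub>R grad V z) \<bullet> b"
    proof (cases "z \<in> U")
      case True
      then have "GDERIV V z :> grad V z" using grad grad_eq by metis
      then have V': "(V has_derivative (\<lambda>h. h \<bullet> grad V z)) (at (z + 0 *\<^sub>R b))"
        unfolding gderiv_def by simp
      have line: "((\<lambda>t. z + t *\<^sub>R b) has_derivative (\<lambda>t. t *\<^sub>R b)) (at (0::real))"
        by (auto intro!: derivative_eq_intros)
      have "((\<lambda>t. V (z + t *\<^sub>R b)) has_derivative (\<lambda>t. t * (b \<bullet> grad V z))) (at 0)"
        using has_derivative_compose[OF line V'] by simp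
      then have "((\<lambda>t. V (z + t *\<^sub>R b)) has_field_derivative (b \<bullet> grad V z)) (at 0)"
        by (simp add: has_field_derivative_def mult.commute[of _ "b \<bullet> grad V z"])
      then have "((\<lambda>t. (V (z + t *\<^sub>R b) - V z) / t) \<longlongrightarrow> b \<bullet> grad V z) (at 0)"
        by (simp add: has_field_derivative_iff)
      moreover have "filterlim (\<lambda>n. 1 / real (Suc n)) (at 0) sequentially"
        unfolding filterlim_at using LIMSEQ_inverse_real_of_nat by (auto simp: inverse_eq_divide)
      ultimately have "(\<lambda>n. (V (z + (1 / real (Suc n)) *\<^sub>R b) - V z) / (1 / real (Suc n))) \<longlonglongrightarrow> b \<bullet> grad V z"
        by (rule filterlim_compose)
      then show ?thesis
        using True by (simp add: d_def inner_commute)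
    qed (simp add: d_def)
  qed
qed

text \<open>By Fubini the integral splits into the finite measure of \<open>\<Omega>\<close> and a
  one-dimensional power integral, finite at 0 because the exponent exceeds -1.\<close>

lemma integrable_cylinder_powr:
  fixes \<Omega> :: "(real^'n) set"
  assumes \<Omega>: "open \<Omega>" "bounded \<Omega>" and "- 1 < a" "0 \<le> yp"
  shows "integrable lborel (\<lambda>z. indicator (cylinder \<Omega> yp) z * snd z powr a)"
proof -
  have [measurable]: "\<Omega> \<in> sets borel" using \<Omega> by simp
  have "(\<lambda>t. t powr a) absolutely_integrable_on {0..yp}"
    using integrable_on_powr_from_0[OF assms(3,4)]
    by (intro nonnegative_absolutely_integrable_1) auto
  then have "set_integrable lebesgue {0<..<yp} (\<lambda>t. t powr a)"
    by (rule set_integrable_subset) auto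
  then have line: "integrable lborel (\<lambda>t. indicator {0<..<yp} t * t powr a)"
    unfolding set_integrable_def by (subst (asm) integrable_completion) simp_all
  have base: "integrable lborel (indicator \<Omega> :: real^'n \<Rightarrow> real)"
    using emeasure_bounded_finite[OF \<Omega>(2)] by (intro integrable_real_indicator) auto
  have split: "indicator (cylinder \<Omega> yp) (x, t) * t powr a =
      indicator \<Omega> x * (indicator {0<..<yp} t * t powr a)" for x t
    by (simp add: cylinder_def indicator_def)
  have "integrable (lborel \<Otimes>\<^sub>M lborel) (\<lambda>z. indicator (cylinder \<Omega> yp) z * snd z powr a)"
  proof (rule lborel_pair.Fubini_integrable)
    show "(\<lambda>z. indicator (cylinder \<Omega> yp) z * snd z powr a) \<in> borel_measurable (lborel \<Otimes>\<^sub>M lborel)"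
      unfolding cylinder_def by measurable
    show "integrable lborel (\<lambda>x. \<integral>t. norm (indicator (cylinder \<Omega> yp) (x, t) * snd (x, t) powr a) \<partial>lborel)"
      using base by (simp add: split abs_mult)
    show "AE x in lborel. integrable lborel (\<lambda>t. indicator (cylinder \<Omega> yp) (x, t) * snd (x, t) powr a)"
      using line by (simp add: split)
  qed
  then show ?thesis
    by (simp add: lborel_prod)
qed

text \<open>A nonnegative integrand with integral 0 vanishes almost everywhere once it is
  integrable. Integrability is shown for a Borel substitute \<open>g\<close>, dominated by
  \<open>C\<^sup>2\<close> times the weight.\<close>

lemma fe_norm_eq_0_imp_grad:
  fixes \<Omega> :: "(real^'n) set"
  assumes \<Omega>: "open \<Omega>" "bounded \<Omega>"
    and mesh: "conforming_mesh \<Omega> \<T>" and part: "interval_partition y M yp" and "0 < yp"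
    and V: "V \<in> fe_space \<Omega> \<T> y M" and s: "s < 1" and zero: "fe_norm \<Omega> yp s V = 0"
  shows "AE z in lebesgue. z \<in> cylinder \<Omega> yp \<longrightarrow> grad V z = 0"
proof -
  let ?Z = "cylinder \<Omega> yp"
  let ?f = "\<lambda>z. indicator ?Z z * (snd z powr (1 - 2 * s) * (norm (grad V z))\<^sup>2)"
  obtain U C where U: "open U" and neg: "negligible (?Z - U)"
    and C: "\<And>z. z \<in> U \<Longrightarrow> \<exists>g. GDERIV V z :> g \<and> norm g \<le> C"
    using fe_gradient_bounded[OF mesh part V] by blast
  have yM: "y M = yp" using part unfolding interval_partition_def by simp
  \<comment> \<open>Extension by zero makes \<open>V\<close> Borel on the whole space, although
    continuity is known only on the closed cylinder.\<close>
  have "V = (\<lambda>z. indicator (closure ?Z) z *\<^sub>R V z)"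
    using V unfolding fe_space_def yM by (auto simp: indicator_def fun_eq_iff)
  moreover have "(\<lambda>z. indicator (closure ?Z) z *\<^sub>R V z) \<in> borel_measurable borel"
    using V unfolding fe_space_def yM by (intro borel_measurable_continuous_on_indicator) auto
  ultimately have "V \<in> borel_measurable borel" by metis
  from borel_measurable_grad[OF this U] C
  have G: "(\<lambda>z. indicator U z *\<^sub>R grad V z) \<in> borel_measurable borel" by blast
  have oZ: "open ?Z" unfolding cylinder_def using \<Omega>(1) by (intro open_Times) auto
  then have [measurable]: "?Z \<in> sets borel" by simp
  have AE_U: "AE z in lebesgue. z \<in> ?Z \<longrightarrow> z \<in> U"
    using neg unfolding negligible_iff_null_sets by (intro AE_I'[OF _]) auto
  \<comment> \<open>Cutting off to \<open>U\<close> makes the gradient measurable and bounded while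
    changing the integrand only on a null set.\<close>
  define g where "g = (\<lambda>z. indicator ?Z z * (snd z powr (1 - 2 * s) * (norm (indicator U z *\<^sub>R grad V z))\<^sup>2))"
  have g_meas: "g \<in> borel_measurable borel"
  proof -
    define G' where "G' = (\<lambda>z. indicator U z *\<^sub>R grad V z)"
    have [measurable]: "G' \<in> borel_measurable borel"
      unfolding G'_def by (rule G)
    have [measurable]: "(snd :: (real^'n) \<times> real \<Rightarrow> real) \<in> borel_measurable borel"
      by (intro borel_measurable_continuous_onI continuous_on_snd continuous_on_id)
    have "g = (\<lambda>z. indicator ?Z z * (snd z powr (1 - 2 * s) * (norm (G' z))\<^sup>2))"
      unfolding g_def G'_def ..
    also have "\<dots> \<in> borel_measurable borel"
      by measurable
    finally show ?thesis .
  qed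
  \<comment> \<open>From \<open>s < 1\<close> the exponent \<open>1 - 2 * s\<close> exceeds
    -1.\<close>
  have "integrable lborel (\<lambda>z. C\<^sup>2 * (indicator ?Z z * snd z powr (1 - 2 * s)))"
    using s \<open>0 < yp\<close> by (intro integrable_mult_right integrable_cylinder_powr \<Omega>) auto
  then have "integrable lborel g"
  proof (rule Bochner_Integration.integrable_bound)
    show "g \<in> borel_measurable lborel" using g_meas by simp
    have "norm (g z) \<le> norm (C\<^sup>2 * (indicator ?Z z * snd z powr (1 - 2 * s)))" for z
    proof (cases "z \<in> U")
      case True
      then have "norm (grad V z) \<le> C" using C grad_eq by metis
      then have "(norm (grad V z))\<^sup>2 \<le> C\<^sup>2" by (intro power_mono) auto
      from mult_right_mono[OF this, of "indicator ?Z z * snd z powr (1 - 2 * s)"]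
      show ?thesis using True by (simp add: g_def algebra_simps)
    qed (simp add: g_def)
    then show "AE z in lborel. norm (g z) \<le> norm (C\<^sup>2 * (indicator ?Z z * snd z powr (1 - 2 * s)))"
      by blast
  qed
  then have gint: "integrable lebesgue g"
    using g_meas by (subst integrable_completion) simp_all
  have ae: "AE z in lebesgue. g z = ?f z"
    using AE_U by eventually_elim (auto simp: g_def indicator_def)
  have f_meas: "?f \<in> borel_measurable lebesgue"
    using borel_measurable_integrable[OF gint] ae by (rule borel_measurable_AE)
  have "integral\<^sup>L lebesgue g = integral\<^sup>L lebesgue ?f"
    using gint f_meas ae by (intro integral_cong_AE) auto
  also have "\<dots> = 0"
    using zero unfolding fe_norm_def set_lebesgue_integral_def by simp
  finally have "AE z in lebesgue. g z = 0"
    using gint by (subst (asm) integral_nonneg_eq_0_iff_AE) (auto simp: g_def)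
  \<comment> \<open>On the cylinder \<open>snd z\<close> is positive, so the weight is nonzero and
    can be cancelled.\<close>
  then show ?thesis
    using ae by eventually_elim (auto simp: cylinder_def)
qed

text \<open>The weight exponent is arbitrary: a gradient found to vanish from the norm at one
  \<open>s\<close> annihilates the forms at all the nodes.\<close>

lemma a_form_eq_0:
  assumes "(AE z in lebesgue. z \<in> cylinder \<Omega> yp \<longrightarrow> grad w z = 0) \<or>
    (AE z in lebesgue. z \<in> cylinder \<Omega> yp \<longrightarrow> grad v z = 0)"
  shows "a_form \<Omega> yp s w v = 0"
proof -
  have "AE z in lebesgue. indicator (cylinder \<Omega> yp) z *\<^sub>R
      (snd z powr (1 - 2 * s) * (grad w z \<bullet> grad v z)) = 0"
    using assms by (auto simp: indicator_def elim!: AE_mp)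
  then show ?thesis
    unfolding a_form_def set_lebesgue_integral_def by (simp add: integral_eq_zero_AE)
qed

section \<open>Comparison of the inf-sup values\<close>

lemma fe_norm_nonneg: "0 \<le> fe_norm \<Omega> yp s w"
  unfolding fe_norm_def set_lebesgue_integral_def by (auto intro!: integral_nonneg)

text \<open>Because \<open>\<beta>\<close> is positive, only \<open>v\<close> with
  \<open>b w v\<close> positive matter for the supremum, so the quotients need to be compared only
  there.\<close>

lemma inf_sup_mono:
  assumes "0 < \<beta>" and le: "ereal \<beta> \<le> inf_sup X b"
    and step: "\<And>w v. w \<in> X - {\<lambda>_. 0} \<Longrightarrow> v \<in> X - {\<lambda>_. 0} \<Longrightarrow> 0 < b w v \<Longrightarrow> b w v \<le> b' w v"
  shows "ereal \<beta> \<le> inf_sup X b'"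
  unfolding inf_sup_def
proof (rule INF_greatest)
  fix w assume w: "w \<in> X - {\<lambda>_. 0}"
  have sup: "ereal \<beta> \<le> (SUP v \<in> X - {\<lambda>_. 0}. ereal (b w v))"
    using le w unfolding inf_sup_def by (meson INF_lower order_trans)
  show "ereal \<beta> \<le> (SUP v \<in> X - {\<lambda>_. 0}. ereal (b' w v))"
    unfolding le_SUP_iff
  proof (intro allI impI)
    fix c assume "c < ereal \<beta>"
    \<comment> \<open>Raising the threshold to at least 0 forces the \<open>v\<close> found below to
      have a positive quotient, as \<open>step\<close> demands.\<close>
    then have "max 0 c < ereal \<beta>" using assms(1) by simp
    then obtain v where v: "v \<in> X - {\<lambda>_. 0}" "max 0 c < ereal (b w v)"
      using sup unfolding le_SUP_iff by blast
    then have "b w v \<le> b' w v" using step[OF w v(1)] by simp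
    then have "c < ereal (b' w v)" using v(2) by (meson ereal_less_eq(3) less_le_trans max_less_iff_conj)
    then show "\<exists>v\<in>X - {\<lambda>_. 0}. c < ereal (b' w v)" using v(1) by blast
  qed
qed

theorem theorem2:
  fixes \<Omega> :: "(real^'n) set" and yp \<sigma> :: real
    and \<T> :: "(real^'n) cell set" and y :: "nat \<Rightarrow> real" and M :: nat
    and E :: "(real^'p) set"
    and Q :: nat and node :: "nat \<Rightarrow> real" and \<theta> :: "nat \<Rightarrow> real \<Rightarrow> real"
    and X :: "((real^'n) \<times> real \<Rightarrow> real) set" and D :: "(real \<times> (real^'p)) set"
    and nstar :: "((real^'n) \<times> real \<Rightarrow> real) \<Rightarrow> real"
    and \<eta> \<beta>LB :: "real \<times> (real^'p) \<Rightarrow> real"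
    and \<beta>h \<beta>hstar :: "real \<times> (real^'p) \<Rightarrow> ereal"
  assumes "polyhedral_lipschitz_domain \<Omega>" and "0 < yp"
    and "conforming_mesh \<Omega> \<T>" and "quasi_uniform \<sigma> \<T>"
    and "interval_partition y M yp"
    and X: "X = fe_space \<Omega> \<T> y M"
    and D: "D = {0<..<1} \<times> E"
    and "1 \<le> Q" and "inj_on node {1..Q}" and "node ` {1..Q} \<subseteq> {0<..<1}"
    and "norm_on X nstar"
    and "\<And>\<mu>. \<mu> \<in> D \<Longrightarrow> 0 < \<eta> \<mu>"
    and "\<And>s \<nu> w. (s, \<nu>) \<in> D \<Longrightarrow> w \<in> X \<Longrightarrow> fe_norm \<Omega> yp s w \<le> \<eta> (s, \<nu>) * nstar w"
    and \<beta>h: "\<And>s \<nu>. (s, \<nu>) \<in> D \<Longrightarrow> \<beta>h (s, \<nu>) =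
      inf_sup X (\<lambda>w v. a_EIM \<Omega> yp Q node \<theta> s w v / (fe_norm \<Omega> yp s w * fe_norm \<Omega> yp s v))"
    and \<beta>hstar: "\<And>s \<nu>. (s, \<nu>) \<in> D \<Longrightarrow> \<beta>hstar (s, \<nu>) =
      inf_sup X (\<lambda>w v. \<Sum>q=1..Q. \<theta> q s / (\<eta> (s, \<nu>))\<^sup>2 *
        (a_form \<Omega> yp (node q) w v / (nstar w * nstar v)))"
    and "\<And>\<mu>. \<mu> \<in> D \<Longrightarrow> 0 < \<beta>LB \<mu> \<and> ereal (\<beta>LB \<mu>) \<le> \<beta>hstar \<mu>"
  shows "\<forall>\<mu>\<in>D. 0 < \<beta>LB \<mu> \<and> ereal (\<beta>LB \<mu>) \<le> \<beta>h \<mu>"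
proof
  fix \<mu> assume \<mu>: "\<mu> \<in> D"
  obtain s \<nu> where \<mu>_eq: "\<mu> = (s, \<nu>)" by (cases \<mu>)
  note sD = \<mu>[unfolded \<mu>_eq]
  have s: "s < 1" using sD D by auto
  have \<Omega>: "open \<Omega>" "bounded \<Omega>"
    using assms(1) unfolding polyhedral_lipschitz_domain_def by auto
  have \<beta>: "0 < \<beta>LB \<mu>" "ereal (\<beta>LB \<mu>) \<le> \<beta>hstar (s, \<nu>)"
    using assms(16)[OF \<mu>] \<mu>_eq by auto
  have \<eta>: "0 < \<eta> (s, \<nu>)" using assms(12)[OF sD] .
  have "ereal (\<beta>LB \<mu>) \<le> \<beta>h (s, \<nu>)"
    unfolding \<beta>h[OF sD]
  proof (rule inf_sup_mono[OF \<beta>(1) \<beta>(2)[unfolded \<beta>hstar[OF sD]]])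
    fix w v assume "w \<in> X - {\<lambda>_. 0}" "v \<in> X - {\<lambda>_. 0}"
    then have wX: "w \<in> X" and vX: "v \<in> X" and n: "0 < nstar w" "0 < nstar v"
      using assms(11) unfolding norm_on_def by (auto simp: order_less_le)
    let ?A = "a_EIM \<Omega> yp Q node \<theta> s w v"
    let ?w = "fe_norm \<Omega> yp s w" and ?v = "fe_norm \<Omega> yp s v"
    let ?b = "\<Sum>q=1..Q. \<theta> q s / (\<eta> (s, \<nu>))\<^sup>2 * (a_form \<Omega> yp (node q) w v / (nstar w * nstar v))"
    \<comment> \<open>Pulling out the common denominator shows both quotients to have the same
      numerator \<open>?A\<close>.\<close>
    have b: "?b = ?A / ((\<eta> (s, \<nu>) * nstar w) * (\<eta> (s, \<nu>) * nstar v))"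
      unfolding a_EIM_def sum_divide_distrib by (intro sum.cong) (auto simp: power2_eq_square)
    assume "0 < ?b"
    then have A: "0 < ?A"
      unfolding b using mult_pos_pos[OF mult_pos_pos[OF \<eta> n(1)] mult_pos_pos[OF \<eta> n(2)]]
      by (metis zero_less_divide_iff less_asym)
    \<comment> \<open>A nonzero form at some node excludes vanishing weighted norms: either one
      being 0 would make every form at \<open>w\<close>, \<open>v\<close> vanish.\<close>
    have "\<exists>q. a_form \<Omega> yp (node q) w v \<noteq> 0"
    proof (rule ccontr)
      assume "\<not> ?thesis"
      then have "?A = 0" unfolding a_EIM_def by simp
      with A show False by simp
    qed
    then obtain q where q: "a_form \<Omega> yp (node q) w v \<noteq> 0" by blast
    have grad0: "AE z in lebesgue. z \<in> cylinder \<Omega> yp \<longrightarrow> grad u z = 0"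
      if "u \<in> X" "fe_norm \<Omega> yp s u = 0" for u
      using fe_norm_eq_0_imp_grad[OF \<Omega> assms(3,5,2) _ s that(2)] that(1) unfolding X by blast
    have "?w \<noteq> 0"
      using grad0[OF wX] a_form_eq_0[OF disjI1] q by blast
    moreover have "?v \<noteq> 0"
      using grad0[OF vX] a_form_eq_0[OF disjI2] q by blast
    ultimately have pos: "0 < ?w" "0 < ?v"
      using fe_norm_nonneg[of \<Omega> yp s w] fe_norm_nonneg[of \<Omega> yp s v] by linarith+
    have "?w * ?v \<le> (\<eta> (s, \<nu>) * nstar w) * (\<eta> (s, \<nu>) * nstar v)"
      using assms(13)[OF sD wX] assms(13)[OF sD vX] pos by (intro mult_mono) auto
    \<comment> \<open>Shrinking a positive denominator enlarges the quotient because the numerator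
      is positive.\<close>
    then show "?b \<le> ?A / (?w * ?v)"
      unfolding b using A pos by (intro divide_left_mono) (auto intro: mult_pos_pos \<eta> n)
  qed
  then show "0 < \<beta>LB \<mu> \<and> ereal (\<beta>LB \<mu>) \<le> \<beta>h \<mu>"
    using \<beta>(1) \<mu>_eq by simp
qed

end
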